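(* Let $X$ be a Banach space over $\mathbb K\in\{\mathbb R,\mathbb C\}$ with the Daugavet property, and let $f\in X^*\setminus\{0\}$. Then \[ \lambda(\ker f,X)=2. \] Moreover, the following are equivalent. (i) There exists a minimal projection from $X$ onto $\ker f$. (ii) The functional $f$ attains its norm on the unit sphere of $X$, i.e. there is $x\in X$ with $\|x\|=1$ and $|f(x)|=\|f\|$.
   Context: For a closed subspace $E$ of a Banach space $F$, the projection constant of $E$ in $F$ is $\lambda(E,F)=\inf\{\|P\| : P\colon F\to E \text{ bounded linear},\ P|_E=\mathrm{Id}_E\}$. A minimal projection from $F$ onto $E$ is a bounded linear projection $P\colon F\to E$ (that is, $P|_E=\mathrm{Id}_E$) with $\|P\|=\lambda(E,F)$. A Banach space $X$ has the Daugavet property if every bounded rank-one operator $T\colon X\to X$ satisfies $\|\mathrm{Id}_X+T\|=1+\|T\|$. *)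

theory Defs
  imports "HOL-Analysis.Analysis"
begin

text \<open>
  The scalar field is \<open>\<real>\<close> or \<open>\<complex>\<close>, up to isometric isomorphism of real algebras.
\<close>

class real_or_complex = real_normed_field +
  assumes real_or_complex:
    "(\<exists>h :: 'a \<Rightarrow> real. surj h \<and> (\<forall>x y. h (x + y) = h x + h y) \<and> (\<forall>x y. h (x * y) = h x * h y) \<and>
        (\<forall>r x. h (r *\<^sub>R x) = r *\<^sub>R h x) \<and> (\<forall>x. norm (h x) = norm x)) \<or>
     (\<exists>h :: 'a \<Rightarrow> complex. surj h \<and> (\<forall>x y. h (x + y) = h x + h y) \<and> (\<forall>x y. h (x * y) = h x * h y) \<and>
        (\<forall>r x. h (r *\<^sub>R x) = r *\<^sub>R h x) \<and> (\<forall>x. norm (h x) = norm x))"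

instance real :: real_or_complex
  by standard (rule disjI1, rule exI[of _ id], simp)

instance complex :: real_or_complex
  by standard (rule disjI2, rule exI[of _ id], simp add: scaleR_conv_of_real)

text \<open>
  A Banach space over \<open>'k\<close> is a (real) Banach space with a scalar multiplication by \<open>'k\<close> that
  extends the real one and for which the norm is homogeneous.
\<close>

locale banach_space_over = vector_space scale
  for scale :: "'k::real_or_complex \<Rightarrow> 'a::banach \<Rightarrow> 'a" (infixr \<open>*k\<close> 75) +
  assumes scale_of_real: "of_real r *k x = r *\<^sub>R x"
    and norm_scale: "norm (c *k x) = norm c * norm x"
begin

definition bounded_operator :: "('a \<Rightarrow> 'a) \<Rightarrow> bool" where
  "bounded_operator T \<longleftrightarrow> Vector_Spaces.linear scale scale T \<and> bounded_linear T"

definition bounded_functional :: "('a \<Rightarrow> 'k) \<Rightarrow> bool" where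
  "bounded_functional f \<longleftrightarrow> Vector_Spaces.linear scale (*) f \<and> bounded_linear f"

definition Daugavet_property :: bool where
  "Daugavet_property \<longleftrightarrow>
     (\<forall>T. bounded_operator T \<and> dim (range T) = 1 \<longrightarrow> onorm (\<lambda>x. x + T x) = 1 + onorm T)"

text \<open>
  Maps from the whole space to a subspace \<open>E\<close> are represented as self-maps with range in \<open>E\<close>; the
  norm of \<open>E\<close> being inherited, \<^const>\<open>onorm\<close> is the operator norm in either view.
\<close>

definition projection_onto :: "'a set \<Rightarrow> ('a \<Rightarrow> 'a) \<Rightarrow> bool" where
  "projection_onto E P \<longleftrightarrow> bounded_operator P \<and> range P \<subseteq> E \<and> (\<forall>x\<in>E. P x = x)"

text \<open>
  Intended for closed subspaces \<open>E\<close>. The infimum is taken in the extended reals, so that it is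
  \<open>\<infinity>\<close> when \<open>E\<close> is not complemented.
\<close>

definition projection_constant :: "'a set \<Rightarrow> ereal" where
  "projection_constant E = Inf {ereal (onorm P) |P. projection_onto E P}"

definition minimal_projection :: "'a set \<Rightarrow> ('a \<Rightarrow> 'a) \<Rightarrow> bool" where
  "minimal_projection E P \<longleftrightarrow> projection_onto E P \<and> ereal (onorm P) = projection_constant E"

end

end

theory Submission
  imports Defs
begin

text \<open>
  A projection onto the hyperplane \<open>ker f\<close> is determined by one vector: its kernel is a line that
  is not contained in \<open>ker f\<close>, and if \<open>y\<close> spans that line and is normalised by \<open>f y = 1\<close>, then the
  projection is \<open>x \<mapsto> x - f x *k y\<close>. This is the identity plus the rank-one operator
  \<open>x \<mapsto> f x *k (- y)\<close> of norm \<open>\<parallel>f\<parallel> \<parallel>y\<parallel>\<close>, so the Daugavet property computes its norm exactly, as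
  \<open>1 + \<parallel>f\<parallel> \<parallel>y\<parallel>\<close>.

  The whole question is thus how small \<open>\<parallel>f\<parallel> \<parallel>y\<parallel>\<close> can be under the constraint \<open>f y = 1\<close>. It is
  at least \<open>\<bar>f y\<bar> = 1\<close>, comes arbitrarily close to \<open>1\<close> by the definition of \<open>\<parallel>f\<parallel>\<close> as a supremum,
  and equals \<open>1\<close> precisely when \<open>y\<close> points in a direction in which \<open>f\<close> attains its norm.
\<close>

context banach_space_over
begin

lemma linear_rank_one:
  assumes "bounded_functional f"
  shows "Vector_Spaces.linear scale scale (\<lambda>x. f x *k y)"
  using assms vector_space_axioms
  by (simp add: bounded_functional_def Vector_Spaces.linear_iff scale_left_distrib)

lemma scale_scaleR: "(r *\<^sub>R c) *k x = r *\<^sub>R (c *k x)"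
  by (metis scaleR_conv_of_real scale_of_real scale_scale)

lemma bounded_linear_rank_one:
  assumes "bounded_functional f"
  shows "bounded_linear (\<lambda>x. f x *k y)"
proof -
  interpret f: bounded_linear f
    using assms by (simp add: bounded_functional_def)
  obtain K where K: "\<And>x. norm (f x) \<le> norm x * K"
    using f.bounded by blast
  show ?thesis
  proof (rule bounded_linear_intro[where K = "K * norm y"])
    fix x
    show "norm (f x *k y) \<le> norm x * (K * norm y)"
      using mult_right_mono[OF K[of x], of "norm y"] by (simp add: norm_scale mult.assoc)
  qed (simp_all add: f.add f.scaleR scale_left_distrib scale_scaleR)
qed

lemma onorm_rank_one:
  assumes "bounded_functional f"
  shows "onorm (\<lambda>x. f x *k y) = onorm f * norm y"
proof -
  have "onorm (\<lambda>x. f x *k y) = onorm (\<lambda>x. norm y *\<^sub>R f x)"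
    by (simp add: onorm_def norm_scale mult.commute)
  also have "\<dots> = onorm f * norm y"
    using assms by (simp add: onorm_scaleR bounded_functional_def)
  finally show ?thesis .
qed

lemma functional_scale:
  assumes "bounded_functional f"
  shows "f (c *k x) = c * f x"
  using assms by (simp add: bounded_functional_def Vector_Spaces.linear_iff)

lemma functional_normalise:
  assumes "bounded_functional f" and "f x \<noteq> 0"
  shows "f (inverse (f x) *k x) = 1"
  using assms by (simp add: functional_scale)

lemma dim_range_rank_one:
  assumes f: "bounded_functional f" and "f x0 \<noteq> 0" and "y \<noteq> 0"
  shows "dim (range (\<lambda>x. f x *k y)) = 1"
proof -
  have "\<exists>x. c = f x" for c
    by (rule exI[of _ "(c * inverse (f x0)) *k x0"]) (use assms in \<open>simp add: functional_scale\<close>)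
  then have "range (\<lambda>x. f x *k y) = span {y}"
    unfolding span_singleton by auto (metis rangeI)
  then show ?thesis
    using dim_eq_card[of "{y}" "range (\<lambda>x. f x *k y)"] \<open>y \<noteq> 0\<close> by (simp add: span_span)
qed

text \<open>
  The sign is absorbed into the vector: the Daugavet equation is used for \<open>x \<mapsto> f x *k (- y)\<close>,
  whose norm does not see the sign.
\<close>

lemma onorm_hyperplane_projection:
  assumes "Daugavet_property" and f: "bounded_functional f" and "f y \<noteq> 0"
  shows "onorm (\<lambda>x. x - f x *k y) = 1 + onorm f * norm y"
proof -
  have "y \<noteq> 0"
    using assms(3) functional_scale[OF f, of 0 y] by auto
  then have "dim (range (\<lambda>x. f x *k (- y))) = 1"
    by (intro dim_range_rank_one[OF f assms(3)]) simp
  moreover have "bounded_operator (\<lambda>x. f x *k (- y))"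
    unfolding bounded_operator_def
    by (intro conjI linear_rank_one bounded_linear_rank_one f)
  ultimately have "onorm (\<lambda>x. x + f x *k (- y)) = 1 + onorm (\<lambda>x. f x *k (- y))"
    using assms(1) unfolding Daugavet_property_def by blast
  then show ?thesis
    by (simp add: onorm_rank_one[OF f] onorm_neg scale_minus_right)
qed

text \<open>
  Conversely, the vector that belongs to a projection \<open>P\<close> is recovered as \<open>y0 - P y0\<close> for any \<open>y0\<close>
  with \<open>f y0 = 1\<close>: since \<open>x - f x *k y0\<close> is always in \<open>ker f\<close>, it is fixed by \<open>P\<close>.
\<close>

lemma projection_onto_ker_iff:
  assumes f: "bounded_functional f" and "f \<noteq> (\<lambda>x. 0)"
  shows "projection_onto {x. f x = 0} P \<longleftrightarrow> (\<exists>y. f y = 1 \<and> P = (\<lambda>x. x - f x *k y))"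
proof
  interpret f: bounded_linear f
    using f by (simp add: bounded_functional_def)
  assume P: "projection_onto {x. f x = 0} P"
  then have blP: "bounded_linear P" and scaleP: "\<And>c x. P (c *k x) = c *k P x"
    and kerP: "\<And>x. f (P x) = 0" and fixP: "\<And>x. f x = 0 \<Longrightarrow> P x = x"
    unfolding projection_onto_def bounded_operator_def Vector_Spaces.linear_iff by blast+
  interpret P: bounded_linear P by (rule blP)
  obtain y0 where y0: "f y0 = 1"
    using assms functional_normalise by blast
  show "\<exists>y. f y = 1 \<and> P = (\<lambda>x. x - f x *k y)"
  proof (intro exI conjI ext)
    show "f (y0 - P y0) = 1"
      by (simp add: f.diff y0 kerP)
    fix x
    have "P (x - f x *k y0) = x - f x *k y0"
      by (rule fixP) (simp add: f.diff functional_scale[OF f] y0)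
    then show "P x = x - f x *k (y0 - P y0)"
      by (simp add: P.diff scaleP scale_right_diff_distrib diff_eq_eq)
  qed
next
  interpret f: bounded_linear f
    using f by (simp add: bounded_functional_def)
  assume "\<exists>y. f y = 1 \<and> P = (\<lambda>x. x - f x *k y)"
  then obtain y where y: "f y = 1" and P: "P = (\<lambda>x. x - f x *k y)"
    by blast
  have "bounded_linear P"
    unfolding P by (intro bounded_linear_sub bounded_linear_ident bounded_linear_rank_one f)
  moreover have "Vector_Spaces.linear scale scale P"
    using linear_rank_one[OF f, of y] unfolding P
    by (simp add: Vector_Spaces.linear_iff scale_right_diff_distrib)
  ultimately show "projection_onto {x. f x = 0} P"
    by (auto simp: projection_onto_def bounded_operator_def P f.diff functional_scale[OF f] y)
qed

lemma one_le_onorm_mult_norm: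
  assumes "bounded_functional f" and "f y = 1"
  shows "1 \<le> onorm f * norm y"
  using onorm[of f y] assms by (simp add: bounded_functional_def)

lemma onorm_pos_functional:
  assumes "bounded_functional f" and "f \<noteq> (\<lambda>x. 0)"
  shows "0 < onorm f"
  using assms onorm_pos_lt[of f] by (auto simp: bounded_functional_def)

lemma normalised_vector_almost_norming:
  assumes f: "bounded_functional f" and "f \<noteq> (\<lambda>x. 0)" and "0 < e"
  obtains y where "f y = 1" and "onorm f * norm y \<le> 1 + e"
proof -
  have pos: "0 < onorm f"
    using assms onorm_pos_functional by blast
  \<comment> \<open>Since \<open>c\<close> lies below the least bound \<open>\<parallel>f\<parallel>\<close>, it fails as a bound at some \<open>x\<close>; dividing this
    \<open>x\<close> by \<open>f x\<close> loses at most the factor \<open>1 + e\<close>.\<close>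
  define c where "c = onorm f / (1 + e)"
  have c: "0 < c" "c < onorm f" "onorm f = (1 + e) * c"
    using pos \<open>0 < e\<close> by (auto simp: c_def field_simps)
  obtain x where x: "c * norm x < norm (f x)"
    using onorm_bound[of c f] c by (metis less_eq_real_def not_le)
  then have "0 < norm (f x)"
    using c by (smt (verit) mult_nonneg_nonneg norm_ge_zero)
  then have "f x \<noteq> 0" by simp
  show thesis
  proof (rule that)
    show "f (inverse (f x) *k x) = 1"
      by (rule functional_normalise[OF f \<open>f x \<noteq> 0\<close>])
    have "norm (inverse (f x) *k x) = norm x / norm (f x)"
      by (simp add: norm_scale norm_inverse divide_inverse_commute)
    then have "onorm f * norm (inverse (f x) *k x) = (1 + e) * (c * norm x / norm (f x))"
      by (simp only: c(3)) simp
    also have "\<dots> \<le> (1 + e) * 1"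
      using x \<open>f x \<noteq> 0\<close> \<open>0 < e\<close> by (intro mult_left_mono) auto
    finally show "onorm f * norm (inverse (f x) *k x) \<le> 1 + e"
      by simp
  qed
qed

text \<open>
  The two kinds of vectors are rescalings of each other: dividing by \<open>f x\<close> normalises the value of
  \<open>f\<close>, dividing by \<open>\<parallel>y\<parallel>\<close> normalises the vector.
\<close>

lemma norm_attaining_iff_normalised_vector:
  assumes f: "bounded_functional f" and "f \<noteq> (\<lambda>x. 0)"
  shows "(\<exists>x. norm x = 1 \<and> norm (f x) = onorm f) \<longleftrightarrow> (\<exists>y. f y = 1 \<and> onorm f * norm y = 1)"
proof
  assume "\<exists>x. norm x = 1 \<and> norm (f x) = onorm f"
  then obtain x where x: "norm x = 1" "norm (f x) = onorm f"
    by blast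
  then have "f x \<noteq> 0"
    using onorm_pos_functional[OF assms] by auto
  then have "onorm f * norm (inverse (f x) *k x) = 1"
    using x by (simp add: norm_scale norm_inverse flip: x(2))
  then show "\<exists>y. f y = 1 \<and> onorm f * norm y = 1"
    using functional_normalise[OF f \<open>f x \<noteq> 0\<close>] by blast
next
  interpret f: bounded_linear f
    using f by (simp add: bounded_functional_def)
  assume "\<exists>y. f y = 1 \<and> onorm f * norm y = 1"
  then obtain y where y: "f y = 1" "onorm f * norm y = 1"
    by blast
  then have "norm y \<noteq> 0" by auto
  then have "norm ((1 / norm y) *\<^sub>R y) = 1 \<and> norm (f ((1 / norm y) *\<^sub>R y)) = onorm f"
    using y by (simp add: f.scaleR field_simps)
  then show "\<exists>x. norm x = 1 \<and> norm (f x) = onorm f"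
    by blast
qed

lemma projection_constant_ker:
  assumes D: "Daugavet_property" and f: "bounded_functional f" and nz: "f \<noteq> (\<lambda>x. 0)"
  shows "projection_constant {x. f x = 0} = 2"
proof (rule antisym)
  show "2 \<le> projection_constant {x. f x = 0}"
    unfolding projection_constant_def
  proof (rule Inf_greatest, clarify)
    fix P assume "projection_onto {x. f x = 0} P"
    then obtain y where y: "f y = 1" "P = (\<lambda>x. x - f x *k y)"
      using projection_onto_ker_iff[OF f nz] by blast
    then show "2 \<le> ereal (onorm P)"
      using onorm_hyperplane_projection[OF D f, of y] one_le_onorm_mult_norm[OF f y(1)] by simp
  qed
  show "projection_constant {x. f x = 0} \<le> 2"
  proof (rule ereal_le_epsilon2)
    fix e :: real assume "0 < e"
    then obtain y where y: "f y = 1" "onorm f * norm y \<le> 1 + e"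
      using normalised_vector_almost_norming[OF f nz] by blast
    let ?P = "\<lambda>x. x - f x *k y"
    have "projection_onto {x. f x = 0} ?P"
      using projection_onto_ker_iff[OF f nz] y(1) by blast
    then have "projection_constant {x. f x = 0} \<le> ereal (onorm ?P)"
      unfolding projection_constant_def by (intro Inf_lower) blast
    also have "\<dots> \<le> ereal (2 + e)"
      using onorm_hyperplane_projection[OF D f, of y] y by simp
    finally show "projection_constant {x. f x = 0} \<le> 2 + ereal e"
      by simp
  qed
qed

lemma minimal_projection_ker_iff_norm_attaining:
  assumes D: "Daugavet_property" and f: "bounded_functional f" and nz: "f \<noteq> (\<lambda>x. 0)"
  shows "(\<exists>P. minimal_projection {x. f x = 0} P) \<longleftrightarrow> (\<exists>x. norm x = 1 \<and> norm (f x) = onorm f)"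
proof -
  have "(\<exists>P. minimal_projection {x. f x = 0} P) \<longleftrightarrow>
      (\<exists>y. f y = 1 \<and> ereal (onorm (\<lambda>x. x - f x *k y)) = 2)"
    unfolding minimal_projection_def projection_constant_ker[OF assms]
      projection_onto_ker_iff[OF f nz] by blast
  also have "\<dots> \<longleftrightarrow> (\<exists>y. f y = 1 \<and> onorm f * norm y = 1)"
  proof (intro ex_cong1 conj_cong refl)
    fix y assume "f y = 1"
    then show "ereal (onorm (\<lambda>x. x - f x *k y)) = 2 \<longleftrightarrow> onorm f * norm y = 1"
      using onorm_hyperplane_projection[OF D f, of y] by simp
  qed
  also have "\<dots> \<longleftrightarrow> (\<exists>x. norm x = 1 \<and> norm (f x) = onorm f)"
    by (rule norm_attaining_iff_normalised_vector[OF f nz, symmetric])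
  finally show ?thesis .
qed

end

theorem corollary3p3:
  fixes scale :: "'k::real_or_complex \<Rightarrow> 'a::banach \<Rightarrow> 'a"
    and f :: "'a \<Rightarrow> 'k"
  assumes "banach_space_over scale"
    and "banach_space_over.Daugavet_property scale"
    and "banach_space_over.bounded_functional scale f"
    and "f \<noteq> (\<lambda>x. 0)"
  shows "banach_space_over.projection_constant scale {x. f x = 0} = 2 \<and>
    ((\<exists>P. banach_space_over.minimal_projection scale {x. f x = 0} P) \<longleftrightarrow>
     (\<exists>x. norm x = 1 \<and> norm (f x) = onorm f))"
  using banach_space_over.projection_constant_ker[OF assms]
    banach_space_over.minimal_projection_ker_iff_norm_attaining[OF assms]
  by blast

end
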